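(* The linear map $\gamma_\wedge:\mathbf{Sym}\to\mathbf{Sym}\,\hat\otimes\,\mathbf{Sym}$ is a morphism for the ordinary (outer) product of noncommutative symmetric functions, i.e. for all $F,G\in\mathbf{Sym}$, $$\gamma_\wedge(FG)=\gamma_\wedge(F)\,\gamma_\wedge(G).$$ In particular, $\gamma_\wedge$ is completely determined by the images of the elementary functions, which are $\gamma_\wedge(\Lambda_n)=\Lambda_n\otimes\Lambda_n$ for all $n\ge 0$, and this implies the combinatorial inversion formula $$\left(\sum_{n\ge 0}(-1)^n\Lambda_n\otimes\Lambda_n\right)^{-1}=\sum_{\substack{(H,K)\\ \operatorname{Des}(H)\cap\operatorname{Des}(K)=\emptyset}}R_H\otimes R_K,$$ where the sum on the right runs over all $n\ge 0$ and all pairs $(H,K)$ of compositions of the same integer $n$ with $\operatorname{Des}(H)\cap\operatorname{Des}(K)=\emptyset$.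
   Context: $\mathbf{Sym}=\bigoplus_{n\ge0}\mathbf{Sym}_n$ is the algebra of noncommutative symmetric functions over $\mathbb{C}$: the free associative unital algebra on generators $S_1,S_2,\dots$ with $\deg S_n=n$ (and $S_0=1$). The elementary functions $\Lambda_n$ are defined by $\Lambda_0=1$ and $\sum_{k=0}^n(-1)^k\Lambda_kS_{n-k}=0$ for $n\ge1$. A composition $I=(i_1,\dots,i_r)$ of $n$ is a finite sequence of positive integers with sum $n$ (the empty composition is the only composition of $0$); its descent set is $\operatorname{Des}(I)=\{i_1,i_1+i_2,\dots,i_1+\cdots+i_{r-1}\}\subseteq\{1,\dots,n-1\}$, and $l(I)=r$ is its length. Put $S^I=S_{i_1}\cdots S_{i_r}$. The ribbon basis $(R_I)$ of $\mathbf{Sym}$ is defined by $R_I=\sum_{J}(-1)^{l(I)-l(J)}S^J$, where $J$ runs over the compositions of $n$ with $\operatorname{Des}(J)\subseteq\operatorname{Des}(I)$ (so $R_{(n)}=S_n$, $R_{(1^n)}=\Lambda_n$, and $R_\emptyset=1$). For each $n$, the linear map $\gamma_\wedge:\mathbf{Sym}_n\to\mathbf{Sym}_n\otimes\mathbf{Sym}_n$ is defined, for $I$ a composition of $n$, by $$\gamma_\wedge(R_I)=\sum_{\operatorname{Des}(H)\cap\operatorname{Des}(K)=\operatorname{Des}(I)}R_H\otimes R_K,$$ the sum being over pairs $(H,K)$ of compositions of $n$; it is extended linearly to $\mathbf{Sym}$. (It is dual to the product $F_H\wedge F_K=F_I$, with $\operatorname{Des}(I)=\operatorname{Des}(H)\cap\operatorname{Des}(K)$,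 on quasi-symmetric functions of degree $n$, where $(F_I)$ is the basis dual to $(R_I)$.) The product on $\mathbf{Sym}\otimes\mathbf{Sym}$ is $(F\otimes G)(F'\otimes G')=FF'\otimes GG'$, and the notation $\mathbf{Sym}\,\hat\otimes\,\mathbf{Sym}$ denotes the completion of $\mathbf{Sym}\otimes\mathbf{Sym}$ with respect to the grading, in which infinite sums such as those in the inversion formula and their inverses are taken. *)

theory Defs
  imports
    "HOL-Analysis.Infinite_Sum"
    "HOL-Library.Poly_Mapping"
    "HOL-Library.Product_Plus"
begin

section \<open>Compositions\<close>

typedef composition = "{xs :: nat list. 0 \<notin> set xs}"
  morphisms parts Composition
  by (rule exI[of _ "[]"]) simp

setup_lifting type_definition_composition

text \<open>Compositions form the free monoid on the positive integers; addition is concatenation, so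
  that \<open>composition \<Rightarrow>\<^sub>0 complex\<close>, with its convolution product, is the free associative algebra.\<close>

instantiation composition :: monoid_add
begin
lift_definition zero_composition :: composition is "[]" by simp
lift_definition plus_composition :: "composition \<Rightarrow> composition \<Rightarrow> composition" is "(@)" by simp
instance by intro_classes (transfer; simp)+
end

definition weight :: "composition \<Rightarrow> nat" where
  "weight I = sum_list (parts I)"

definition len :: "composition \<Rightarrow> nat" where
  "len I = length (parts I)"

definition Des :: "composition \<Rightarrow> nat set" where
  "Des I = {sum_list (take k (parts I)) |k. 0 < k \<and> k < len I}"

lemma parts_eq_iff: "parts I = parts J \<longleftrightarrow> I = J"
  by (simp add: parts_inject)

lemma zero_notin_parts: "0 \<notin> set (parts I)"
  using parts by blast

lemma finite_weight_le: "finite {I. weight I \<le> n}"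
proof -
  have len: "length xs \<le> sum_list xs" if "0 \<notin> set xs" for xs :: "nat list"
    using that by (induction xs) auto
  have "parts ` {I. weight I \<le> n} \<subseteq> {xs. set xs \<subseteq> {..n} \<and> length xs \<le> n}"
  proof clarify
    fix I
    assume "weight I \<le> n"
    then show "set (parts I) \<subseteq> {..n} \<and> length (parts I) \<le> n"
      using len[OF zero_notin_parts, of I] member_le_sum_list[of _ "parts I"]
      by (force simp: weight_def)
  qed
  moreover have "finite {xs :: nat list. set xs \<subseteq> {..n} \<and> length xs \<le> n}"
    by (rule finite_lists_length_le) simp
  ultimately have "finite (parts ` {I. weight I \<le> n})"
    by (rule finite_subset)
  then show ?thesis
    by (rule finite_imageD) (simp add: inj_on_def parts_eq_iff)
qed

lemma finite_weight_eq [simp]: "finite {I. weight I = n}"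
  by (rule finite_subset[OF _ finite_weight_le[of n]]) auto

lemma finite_splittings [simp]: "finite {(u, v). u + v = (I :: composition)}"
proof -
  have "(u, v) \<in> (\<lambda>k. (Composition (take k (parts I)), Composition (drop k (parts I)))) ` {..length (parts I)}"
    if "u + v = I" for u v
    using that
    by (intro image_eqI[of _ _ "length (parts u)"])
       (auto simp: plus_composition.rep_eq parts_inverse)
  then have "{(u, v). u + v = I} \<subseteq>
      (\<lambda>k. (Composition (take k (parts I)), Composition (drop k (parts I)))) ` {..length (parts I)}"
    by blast
  then show ?thesis
    by (rule finite_subset) simp
qed

lemma finite_splittings' [simp]: "finite {x. fst x + snd x = (I :: composition)}"
  using finite_splittings[of I] by (simp add: case_prod_beta')

text \<open>A composition is determined by its weight and its descent set.\<close>

lemma partial_sums_inj: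
  fixes xs ys :: "nat list"
  defines "D \<equiv> \<lambda>xs :: nat list. {sum_list (take k xs) |k. 0 < k \<and> k < length xs}"
  assumes "0 \<notin> set xs" "0 \<notin> set ys" "sum_list xs = sum_list ys" "D xs = D ys"
  shows "xs = ys"
  using assms(2-)
proof (induction xs arbitrary: ys)
  case Nil
  then show ?case by (cases ys) auto
next
  case (Cons a xs)
  obtain b ys' where ys: "ys = b # ys'"
    using Cons.prems by (cases ys) auto
  have D_Cons: "D (c # zs) = (if zs = [] then {} else insert c ((+) c ` D zs))" for c zs
  proof (cases "zs = []")
    case False
    have D_image: "D zs = (\<lambda>k. sum_list (take k zs)) ` {0<..<length zs}" for zs
      unfolding D_def by auto
    have "{0<..<length (c # zs)} = Suc ` {..<length zs}"
      by (auto simp: image_iff gr0_conv_Suc)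
    moreover have "{..<length zs} = insert 0 {0<..<length zs}"
      using False by auto
    ultimately show ?thesis
      using False unfolding D_image by (simp add: image_image)
  qed (auto simp: D_def)
  have pos: "0 \<notin> D zs" if "0 \<notin> set zs" for zs
    using that unfolding D_def by (cases zs) (auto simp: gr0_conv_Suc)
  show ?case
  proof (cases "xs = []")
    case True
    then have "ys' = []"
      using Cons.prems(4) by (auto simp: ys D_Cons split: if_splits)
    then show ?thesis using True Cons.prems ys by auto
  next
    case False
    then have ne: "ys' \<noteq> []"
      using Cons.prems(4) by (auto simp: ys D_Cons split: if_splits)
    have eq: "insert a ((+) a ` D xs) = insert b ((+) b ` D ys')"
      using Cons.prems(4) False ne by (simp add: ys D_Cons)
    have "a = b"
    proof (rule antisym)
      have "b \<in> insert a ((+) a ` D xs)" using eq by blast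
      then show "a \<le> b" by auto
      have "a \<in> insert b ((+) b ` D ys')" using eq by blast
      then show "b \<le> a" by auto
    qed
    moreover have "a \<notin> (+) a ` D xs" "a \<notin> (+) a ` D ys'"
      using pos[of xs] pos[of ys'] Cons.prems by (auto simp: ys)
    ultimately have "(+) a ` D xs = (+) a ` D ys'"
      using eq by (simp add: insert_ident)
    then have "D xs = D ys'"
      by (simp add: inj_image_eq_iff)
    then show ?thesis
      using Cons.IH[of ys'] Cons.prems \<open>a = b\<close> ys by auto
  qed
qed

lemma Des_inj: "weight I = weight J \<Longrightarrow> Des I = Des J \<Longrightarrow> I = J"
  using partial_sums_inj[OF zero_notin_parts zero_notin_parts, of I J]
  by (simp add: weight_def Des_def len_def parts_eq_iff)

lemma finite_Des [simp]: "finite (Des I)"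
  unfolding Des_def by simp


section \<open>Noncommutative symmetric functions\<close>

type_synonym nsym = "composition \<Rightarrow>\<^sub>0 complex"

definition scale_nsym :: "complex \<Rightarrow> nsym \<Rightarrow> nsym" where
  "scale_nsym c F = Poly_Mapping.single 0 c * F"

text \<open>The generators, with the convention $S_0 = 1$.\<close>

definition S :: "nat \<Rightarrow> nsym" where
  "S n = (if n = 0 then 1 else Poly_Mapping.single (Composition [n]) 1)"

definition S_prod :: "composition \<Rightarrow> nsym" where
  "S_prod I = prod_list (map S (parts I))"

text \<open>This is the relation $\sum_{k=0}^{n} (-1)^k \Lambda_k S_{n-k} = 0$ (for $n \geq 1$),
  solved for $\Lambda_n$; see \<open>Lam_S_relation\<close>.\<close>

fun Lam :: "nat \<Rightarrow> nsym" where
  "Lam 0 = 1"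
| "Lam (Suc n) = (\<Sum>k\<le>n. (-1) ^ (n + k) * Lam k * S (Suc n - k))"

text \<open>If $\mathrm{Des}(J) \subseteq \mathrm{Des}(I)$ then $l(J) \leq l(I)$, so the subtraction on
  the natural numbers is not truncated.\<close>

definition ribbon :: "composition \<Rightarrow> nsym" where
  "ribbon I = (\<Sum>J | weight J = weight I \<and> Des J \<subseteq> Des I.
     scale_nsym ((-1) ^ (len I - len J)) (S_prod J))"

lemma Lam_S_relation:
  assumes "n \<ge> 1"
  shows "(\<Sum>k\<le>n. (-1) ^ k * Lam k * S (n - k)) = 0"
proof -
  obtain m where n: "n = Suc m"
    using assms by (cases n) auto
  have "(-1) ^ Suc m * Lam (Suc m) = - (\<Sum>k\<le>m. (-1) ^ k * Lam k * S (Suc m - k))"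
  proof -
    have "(-1) ^ m * ((-1) ^ (m + k) * Lam k * S (Suc m - k)) = (-1) ^ k * Lam k * S (Suc m - k)" for k
    proof -
      have "(-1) ^ m * (-1) ^ m = (1 :: nsym)"
        by (simp flip: power_add mult_2)
      then show ?thesis
        by (simp add: power_add flip: mult.assoc)
    qed
    then show ?thesis
      by (simp add: sum_distrib_left sum_negf)
  qed
  then show ?thesis
    by (simp add: n S_def)
qed

lemma S_prod_eq_single: "S_prod I = Poly_Mapping.single I 1"
proof -
  have "prod_list (map S xs) = Poly_Mapping.single (Composition xs) 1" if "0 \<notin> set xs" for xs
    using that
  proof (induction xs)
    case Nil
    then show ?case
      by (simp flip: single_one zero_composition_def)
  next
    case (Cons a xs)
    then have "Composition [a] + Composition xs = Composition (a # xs)"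
      by (auto simp: parts_eq_iff[symmetric] plus_composition.rep_eq Composition_inverse)
    with Cons show ?case
      by (auto simp: S_def mult_single)
  qed
  from this[OF zero_notin_parts] show ?thesis
    by (simp add: S_prod_def parts_inverse)
qed

lemma lookup_mult_nsym:
  "Poly_Mapping.lookup (F * G :: nsym) I = (\<Sum>(u, v) | u + v = I. Poly_Mapping.lookup F u * Poly_Mapping.lookup G v)"
proof -
  let ?f = "\<lambda>(u, v). Poly_Mapping.lookup F u * Poly_Mapping.lookup G v when I = u + v"
  have "Poly_Mapping.lookup (F * G) I = Sum_any ?f"
    by (simp add: times_poly_mapping.rep_eq prod_fun_unfold_prod)
  also have "\<dots> = sum ?f {(u, v). u + v = I}"
    by (rule Sum_any.expand_superset) (auto simp: when_def split: if_splits)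
  also have "\<dots> = (\<Sum>(u, v) | u + v = I. Poly_Mapping.lookup F u * Poly_Mapping.lookup G v)"
    by (rule sum.cong) (auto simp: when_def)
  finally show ?thesis .
qed

lemma lookup_scale_nsym: "Poly_Mapping.lookup (scale_nsym c F) I = c * Poly_Mapping.lookup F I"
proof -
  have "Poly_Mapping.lookup (scale_nsym c F) I =
      (\<Sum>(u, v) | u + v = I. (if u = 0 then c else 0) * Poly_Mapping.lookup F v)"
    unfolding scale_nsym_def lookup_mult_nsym
    by (intro sum.cong refl) (auto simp: lookup_single when_def)
  also have "\<dots> = (\<Sum>(u, v) \<in> {(0 :: composition, I)}. (if u = 0 then c else 0) * Poly_Mapping.lookup F v)"
    by (rule sum.mono_neutral_right) (auto split: if_splits)
  finally show ?thesis by simp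
qed

lemma vector_space_nsym: "vector_space scale_nsym"
  by unfold_locales
     (auto intro!: poly_mapping_eqI simp: lookup_scale_nsym lookup_add algebra_simps)


section \<open>The completed tensor square\<close>

text \<open>The products $S^H \otimes S^K$ form a bihomogeneous basis of $\mathbf{Sym} \otimes \mathbf{Sym}$
  whose bihomogeneous components are finite-dimensional. Hence an element of the completion is an
  arbitrary family of coefficients in this basis.\<close>

typedef nsym2 = "UNIV :: (composition \<times> composition \<Rightarrow> complex) set"
  morphisms coeff Nsym2 ..

setup_lifting type_definition_nsym2

lemma nsym2_eqI: "(\<And>H K. coeff x (H, K) = coeff y (H, K)) \<Longrightarrow> x = y"
  by transfer auto

lemma finite_splittings2 [simp]: "finite {(u, v). u + v = (p :: composition \<times> composition)}"
proof -
  have "{(u, v). u + v = p} \<subseteq> (\<lambda>((a, b), (c, d)). ((a, c), (b, d))) `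
    ({(u, v). u + v = fst p} \<times> {(u, v). u + v = snd p})"
    by (force simp: image_iff)
  then show ?thesis
    by (rule finite_subset) (intro finite_imageI finite_cartesian_product finite_splittings)
qed

lemma finite_splittings2' [simp]: "finite {x. fst x + snd x = (p :: composition \<times> composition)}"
  using finite_splittings2[of p] by (simp add: case_prod_beta')

lemma splittings2_assoc:
  fixes p :: "composition \<times> composition" and f :: "_ \<Rightarrow> _ \<Rightarrow> _ \<Rightarrow> complex"
  shows "(\<Sum>(q, w) | q + w = p. \<Sum>(u, v) | u + v = q. f u v w) =
    (\<Sum>(u, q) | u + q = p. \<Sum>(v, w) | v + w = q. f u v w)"
proof -
  have "(\<Sum>(q, w) | q + w = p. \<Sum>(u, v) | u + v = q. f u v w) =
      (\<Sum>((q, w), (u, v)) \<in> Sigma {(q, w). q + w = p} (\<lambda>(q, w). {(u, v). u + v = q}). f u v w)"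
    by (subst sum.Sigma[symmetric]) (auto simp: case_prod_beta' intro!: sum.cong)
  also have "\<dots> = (\<Sum>((u, q), (v, w)) \<in> Sigma {(u, q). u + q = p} (\<lambda>(u, q). {(v, w). v + w = q}). f u v w)"
    by (rule sum.reindex_bij_witness[where
          i = "\<lambda>((u, q), (v, w)). ((u + v, w), (u, v))" and
          j = "\<lambda>((q, w), (u, v)). ((u, v + w), (v, w))"]) (auto simp: add.assoc)
  also have "\<dots> = (\<Sum>(u, q) | u + q = p. \<Sum>(v, w) | v + w = q. f u v w)"
    by (subst sum.Sigma[symmetric]) (auto simp: case_prod_beta' intro!: sum.cong)
  finally show ?thesis .
qed

instantiation nsym2 :: ring_1
begin
lift_definition zero_nsym2 :: nsym2 is "\<lambda>_. 0" .
lift_definition one_nsym2 :: nsym2 is "\<lambda>p. if p = 0 then 1 else 0" .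
lift_definition plus_nsym2 :: "nsym2 \<Rightarrow> nsym2 \<Rightarrow> nsym2" is "\<lambda>x y p. x p + y p" .
lift_definition minus_nsym2 :: "nsym2 \<Rightarrow> nsym2 \<Rightarrow> nsym2" is "\<lambda>x y p. x p - y p" .
lift_definition uminus_nsym2 :: "nsym2 \<Rightarrow> nsym2" is "\<lambda>x p. - x p" .
lift_definition times_nsym2 :: "nsym2 \<Rightarrow> nsym2 \<Rightarrow> nsym2" is
  "\<lambda>x y p. \<Sum>(u, v) | u + v = p. x u * y v" .
instance
proof
  fix a b c :: nsym2
  show "a * b * c = a * (b * c)"
  proof (transfer, rule ext)
    fix a b c :: "composition \<times> composition \<Rightarrow> complex" and p
    have "(\<Sum>(q, w) | q + w = p. (\<Sum>(u, v) | u + v = q. a u * b v) * c w) =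
        (\<Sum>(q, w) | q + w = p. \<Sum>(u, v) | u + v = q. a u * b v * c w)"
      by (intro sum.cong refl) (auto simp: sum_distrib_right intro!: sum.cong)
    also have "\<dots> = (\<Sum>(u, q) | u + q = p. \<Sum>(v, w) | v + w = q. a u * b v * c w)"
      by (rule splittings2_assoc)
    also have "\<dots> = (\<Sum>(u, q) | u + q = p. a u * (\<Sum>(v, w) | v + w = q. b v * c w))"
      by (intro sum.cong refl) (auto simp: sum_distrib_left mult.assoc intro!: sum.cong)
    finally show "(\<Sum>(q, w) | q + w = p. (\<Sum>(u, v) | u + v = q. a u * b v) * c w) =
        (\<Sum>(u, q) | u + q = p. a u * (\<Sum>(v, w) | v + w = q. b v * c w))" .
  qed
  show "1 * a = a"
  proof (transfer, rule ext)
    fix a :: "composition \<times> composition \<Rightarrow> complex" and p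
    have "(\<Sum>(u, v) | u + v = p. (if u = 0 then 1 else 0) * a v) =
        (\<Sum>(u, v) \<in> {(0 :: composition \<times> composition, p)}. (if u = 0 then 1 else 0) * a v)"
      by (rule sum.mono_neutral_right[OF finite_splittings2]) (auto simp: prod_eq_iff split: if_splits)
    then show "(\<Sum>(u, v) | u + v = p. (if u = 0 then 1 else 0) * a v) = a p"
      by simp
  qed
  show "a * 1 = a"
  proof (transfer, rule ext)
    fix a :: "composition \<times> composition \<Rightarrow> complex" and p
    have "(\<Sum>(u, v) | u + v = p. a u * (if v = 0 then 1 else 0)) =
        (\<Sum>(u, v) \<in> {(p, 0 :: composition \<times> composition)}. a u * (if v = 0 then 1 else 0))"
      by (rule sum.mono_neutral_right[OF finite_splittings2]) (auto simp: prod_eq_iff split: if_splits)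
    then show "(\<Sum>(u, v) | u + v = p. a u * (if v = 0 then 1 else 0)) = a p"
      by simp
  qed
  show "(a + b) * c = a * c + b * c"
    by transfer (simp add: fun_eq_iff case_prod_beta' sum.distrib algebra_simps)
  show "a * (b + c) = a * b + a * c"
    by transfer (simp add: fun_eq_iff case_prod_beta' sum.distrib algebra_simps)
  show "(0 :: nsym2) \<noteq> 1"
    by transfer (metis zero_neq_one)
qed (transfer; simp add: fun_eq_iff algebra_simps)+
end

lift_definition scale_nsym2 :: "complex \<Rightarrow> nsym2 \<Rightarrow> nsym2" is "\<lambda>c x p. c * x p" .

definition tensor :: "nsym \<Rightarrow> nsym \<Rightarrow> nsym2" (infixr \<open>\<otimes>\<close> 75) where
  "F \<otimes> G = Nsym2 (\<lambda>(H, K). Poly_Mapping.lookup F H * Poly_Mapping.lookup G K)"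

lemma coeff_tensor [simp]:
  "coeff (F \<otimes> G) (H, K) = Poly_Mapping.lookup F H * Poly_Mapping.lookup G K"
  by (simp add: tensor_def Nsym2_inverse)

lemma vector_space_nsym2: "vector_space scale_nsym2"
  by unfold_locales (transfer; auto simp: fun_eq_iff algebra_simps)+

lemma tensor_mult: "(F \<otimes> G) * (F' \<otimes> G') = (F * F') \<otimes> (G * G')"
proof (rule nsym2_eqI)
  fix H K :: composition
  have "coeff ((F \<otimes> G) * (F' \<otimes> G')) (H, K) =
      (\<Sum>(u, v) | u + v = (H, K). coeff (F \<otimes> G) u * coeff (F' \<otimes> G') v)"
    by (simp add: times_nsym2.rep_eq)
  also have "\<dots> = (\<Sum>((a, b), (c, d)) \<in> {(a, b). a + b = H} \<times> {(c, d). c + d = K}.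
      coeff (F \<otimes> G) (a, c) * coeff (F' \<otimes> G') (b, d))"
    by (rule sum.reindex_bij_witness[where
          i = "\<lambda>((a, b), (c, d)). ((a, c), (b, d))" and
          j = "\<lambda>((a, c), (b, d)). ((a, b), (c, d))"]) auto
  also have "\<dots> = (\<Sum>(a, b) | a + b = H. \<Sum>(c, d) | c + d = K.
      (Poly_Mapping.lookup F a * Poly_Mapping.lookup F' b) *
      (Poly_Mapping.lookup G c * Poly_Mapping.lookup G' d))"
    by (subst sum.cartesian_product[symmetric]) (auto simp: case_prod_beta' mult_ac intro!: sum.cong)
  also have "\<dots> = coeff ((F * F') \<otimes> (G * G')) (H, K)"
    by (simp add: lookup_mult_nsym sum_product case_prod_beta')
  finally show "coeff ((F \<otimes> G) * (F' \<otimes> G')) (H, K) = coeff ((F * F') \<otimes> (G * G')) (H, K)" .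
qed

text \<open>The topology defined by the grading: $x$ and $y$ are close if they agree up to a high total degree.\<close>

definition agree_upto :: "nat \<Rightarrow> nsym2 \<Rightarrow> nsym2 \<Rightarrow> bool" where
  "agree_upto n x y \<longleftrightarrow> (\<forall>H K. weight H + weight K \<le> n \<longrightarrow> coeff x (H, K) = coeff y (H, K))"

lemma agree_upto_refl [simp]: "agree_upto n x x"
  by (simp add: agree_upto_def)

lemma agree_upto_trans: "agree_upto n x y \<Longrightarrow> agree_upto n y z \<Longrightarrow> agree_upto n x z"
  by (simp add: agree_upto_def)

lemma agree_upto_mono: "agree_upto n x y \<Longrightarrow> m \<le> n \<Longrightarrow> agree_upto m x y"
  by (simp add: agree_upto_def)

instantiation nsym2 :: topological_space
begin
definition open_nsym2 :: "nsym2 set \<Rightarrow> bool" where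
  "open U \<longleftrightarrow> (\<forall>x\<in>U. \<exists>n. \<forall>y. agree_upto n y x \<longrightarrow> y \<in> U)"
instance
proof
  show "open (UNIV :: nsym2 set)"
    by (simp add: open_nsym2_def)
next
  fix U V :: "nsym2 set"
  assume UV: "open U" "open V"
  show "open (U \<inter> V)"
    unfolding open_nsym2_def
  proof
    fix x
    assume "x \<in> U \<inter> V"
    then obtain m n where
      m: "\<And>y. agree_upto m y x \<Longrightarrow> y \<in> U" and
      n: "\<And>y. agree_upto n y x \<Longrightarrow> y \<in> V"
      using UV unfolding open_nsym2_def by blast
    have "y \<in> U \<inter> V"
      if "agree_upto (m + n) y x" for y
      using that by (intro IntI m n) (rule agree_upto_mono, assumption, simp)+
    then show "\<exists>n. \<forall>y. agree_upto n y x \<longrightarrow> y \<in> U \<inter> V"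
      by blast
  qed
next
  fix \<U> :: "nsym2 set set"
  assume "\<forall>U\<in>\<U>. open U"
  then show "open (\<Union>\<U>)"
    unfolding open_nsym2_def by (metis UnionE UnionI)
qed
end

lemma eventually_nhds_nsym2:
  "eventually P (nhds x) \<longleftrightarrow> (\<exists>n. \<forall>y. agree_upto n y x \<longrightarrow> P y)"
proof
  assume "eventually P (nhds x)"
  then obtain U where "open U" "x \<in> U" "\<forall>y\<in>U. P y"
    unfolding eventually_nhds by blast
  then show "\<exists>n. \<forall>y. agree_upto n y x \<longrightarrow> P y"
    unfolding open_nsym2_def by blast
next
  assume "\<exists>n. \<forall>y. agree_upto n y x \<longrightarrow> P y"
  then obtain n where n: "\<And>y. agree_upto n y x \<Longrightarrow> P y"
    by blast
  have "open {y. agree_upto n y x}"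
    unfolding open_nsym2_def
    by (intro ballI exI[of _ n] allI impI CollectI, drule CollectD, rule agree_upto_trans)
  then show "eventually P (nhds x)"
    unfolding eventually_nhds
    by (intro exI[of _ "{y. agree_upto n y x}"]) (simp add: n)
qed

lemma eventually_agree: "eventually (\<lambda>y. agree_upto n y x) (nhds x)"
  unfolding eventually_nhds_nsym2 by (intro exI[of _ n]) simp

lemma tendsto_nsym2_iff:
  "(f \<longlongrightarrow> x) A \<longleftrightarrow> (\<forall>n. eventually (\<lambda>z. agree_upto n (f z) x) A)"
proof
  assume "(f \<longlongrightarrow> x) A"
  then show "\<forall>n. eventually (\<lambda>z. agree_upto n (f z) x) A"
    using eventually_compose_filterlim[OF eventually_agree] by blast
next
  assume *: "\<forall>n. eventually (\<lambda>z. agree_upto n (f z) x) A"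
  show "(f \<longlongrightarrow> x) A"
    unfolding filterlim_iff
  proof (intro allI impI)
    fix P
    assume "eventually P (nhds x)"
    then obtain n where n: "\<And>y. agree_upto n y x \<Longrightarrow> P y"
      unfolding eventually_nhds_nsym2 by blast
    from *[rule_format, of n] show "eventually (\<lambda>z. P (f z)) A"
      by (rule eventually_mono) (rule n)
  qed
qed

instance nsym2 :: topological_ab_group_add
proof
  fix a b :: nsym2
  show "((\<lambda>x. fst x + snd x) \<longlongrightarrow> a + b) (nhds a \<times>\<^sub>F nhds b)"
    unfolding tendsto_nsym2_iff
  proof
    fix n
    from eventually_agree[of n a] eventually_agree[of n b] have "eventually (\<lambda>z. agree_upto n (fst z) a \<and> agree_upto n (snd z) b) (nhds a \<times>\<^sub>F nhds b)"
      unfolding eventually_prod_filter by auto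
    then show "eventually (\<lambda>z. agree_upto n (fst z + snd z) (a + b)) (nhds a \<times>\<^sub>F nhds b)"
      by (rule eventually_mono) (simp add: agree_upto_def plus_nsym2.rep_eq)
  qed
  show "(uminus \<longlongrightarrow> - a) (nhds a)"
    unfolding tendsto_nsym2_iff eventually_nhds_nsym2 by (auto simp: agree_upto_def uminus_nsym2.rep_eq)
qed

instance nsym2 :: t2_space
proof
  fix x y :: nsym2
  assume "x \<noteq> y"
  then obtain H K where HK: "coeff x (H, K) \<noteq> coeff y (H, K)"
    using nsym2_eqI by blast
  have "open {z. coeff z (H, K) = c}" for c
    unfolding open_nsym2_def agree_upto_def by (auto intro!: exI[of _ "weight H + weight K"])
  with HK show "\<exists>U V. open U \<and> open V \<and> x \<in> U \<and> y \<in> V \<and> U \<inter> V = {}"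
    by (intro exI[of _ "{z. coeff z (H, K) = coeff x (H, K)}"]
          exI[of _ "{z. coeff z (H, K) = coeff y (H, K)}"]) auto
qed


section \<open>The coproduct\<close>

lemma nsym_expansion:
  "F = (\<Sum>I\<in>Poly_Mapping.keys F. scale_nsym (Poly_Mapping.lookup F I) (S_prod I))"
proof (rule poly_mapping_eqI)
  fix J
  have "(\<Sum>I\<in>Poly_Mapping.keys F. Poly_Mapping.lookup F I * (1 when I = J)) = Poly_Mapping.lookup F J"
    by (cases "J \<in> Poly_Mapping.keys F")
       (auto simp: when_def in_keys_iff if_distrib[of "(*) _"] sum.delta cong: if_cong)
  then show "Poly_Mapping.lookup F J = Poly_Mapping.lookup
      (\<Sum>I\<in>Poly_Mapping.keys F. scale_nsym (Poly_Mapping.lookup F I) (S_prod I)) J"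
    by (simp add: lookup_sum lookup_scale_nsym S_prod_eq_single lookup_single)
qed

lemma ribbon_rec:
  "ribbon I = S_prod I + (\<Sum>J | weight J = weight I \<and> Des J \<subset> Des I.
     scale_nsym ((-1) ^ (len I - len J)) (S_prod J))"
proof -
  have eq: "{J. weight J = weight I \<and> Des J \<subseteq> Des I} =
      insert I {J. weight J = weight I \<and> Des J \<subset> Des I}"
    by (auto dest: Des_inj)
  have "finite {J. weight J = weight I \<and> Des J \<subset> Des I}"
    by (rule finite_subset[OF _ finite_weight_eq[of "weight I"]]) auto
  moreover have "scale_nsym 1 F = F" for F
    by (rule poly_mapping_eqI) (simp add: lookup_scale_nsym)
  ultimately show ?thesis
    unfolding ribbon_def eq by (subst sum.insert) auto
qed

lemma linear_eqI_ribbon: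
  assumes f: "Vector_Spaces.linear scale_nsym s f" and g: "Vector_Spaces.linear scale_nsym s g"
    and eq: "\<And>I. f (ribbon I) = g (ribbon I)"
  shows "f = g"
proof -
  interpret f: Vector_Spaces.linear scale_nsym s f by fact
  interpret g: Vector_Spaces.linear scale_nsym s g by fact
  have S: "f (S_prod I) = g (S_prod I)" for I
  proof (induction "card (Des I)" arbitrary: I rule: less_induct)
    case less
    have "f (S_prod J) = g (S_prod J)" if "Des J \<subset> Des I" for J
      using that by (intro less psubset_card_mono) auto
    with eq[of I] show ?case
      by (simp add: ribbon_rec f.add g.add f.sum g.sum f.scale g.scale)
  qed
  show ?thesis
  proof
    fix F
    show "f F = g F"
      by (subst (1 2) nsym_expansion[of F]) (simp add: f.sum g.sum f.scale g.scale S)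
  qed
qed

lemma linear_extension_ribbon:
  fixes h :: "composition \<Rightarrow> nsym2"
  shows "\<exists>g. Vector_Spaces.linear scale_nsym scale_nsym2 g \<and> (\<forall>I. g (ribbon I) = h I)"
proof -
  interpret V1: vector_space scale_nsym by (rule vector_space_nsym)
  interpret V2: vector_space scale_nsym2 by (rule vector_space_nsym2)
  define G where "G k I = h I - (\<Sum>J | weight J = weight I \<and> Des J \<subset> Des I.
    scale_nsym2 ((-1) ^ (len I - len J)) (k J))" for k I
  define k where "k = wfrec (inv_image finite_psubset Des) G"
  have wf: "wf (inv_image finite_psubset Des)"
    by (intro wf_inv_image wf_finite_psubset)
  have k: "k I = h I - (\<Sum>J | weight J = weight I \<and> Des J \<subset> Des I.
      scale_nsym2 ((-1) ^ (len I - len J)) (k J))" for I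
    unfolding k_def
    by (subst wfrec[OF wf]) (auto simp: G_def cut_apply finite_psubset_def intro!: sum.cong)
  define g where "g F = (\<Sum>I\<in>Poly_Mapping.keys F. scale_nsym2 (Poly_Mapping.lookup F I) (k I))" for F
  have g: "g F = (\<Sum>I\<in>A. scale_nsym2 (Poly_Mapping.lookup F I) (k I))"
    if "finite A" "Poly_Mapping.keys F \<subseteq> A" for A F
    unfolding g_def using that by (intro sum.mono_neutral_left) (auto simp: in_keys_iff)
  have lin: "Vector_Spaces.linear scale_nsym scale_nsym2 g"
  proof (rule Vector_Spaces.linear_iff[THEN iffD2], intro conjI allI)
    show "vector_space scale_nsym" "vector_space scale_nsym2" by unfold_locales
    fix F F' :: nsym and c
    show "g (F + F') = g F + g F'"
      using g[of "Poly_Mapping.keys F \<union> Poly_Mapping.keys F'"] Poly_Mapping.keys_add[of F F']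
      by (simp add: lookup_add V2.scale_left_distrib sum.distrib)
    have "Poly_Mapping.keys (scale_nsym c F) \<subseteq> Poly_Mapping.keys F"
      by (auto simp: in_keys_iff lookup_scale_nsym)
    then show "g (scale_nsym c F) = scale_nsym2 c (g F)"
      using g[of "Poly_Mapping.keys F" "scale_nsym c F"] g[of "Poly_Mapping.keys F" F]
      by (simp add: lookup_scale_nsym V2.scale_sum_right)
  qed
  interpret g: Vector_Spaces.linear scale_nsym scale_nsym2 g by fact
  have gS: "g (S_prod I) = k I" for I
    by (simp add: g_def S_prod_eq_single)
  have "g (ribbon I) = h I" for I
    using k[of I] by (simp add: ribbon_rec g.add g.sum g.scale gS)
  with lin show ?thesis by blast
qed

text \<open>The linear map with the prescribed values on the ribbon basis; existence and uniqueness are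
  given by \<open>linear_extension_ribbon\<close> and \<open>linear_eqI_ribbon\<close>.\<close>

definition gamma_wedge :: "nsym \<Rightarrow> nsym2" where
  "gamma_wedge = (THE g. Vector_Spaces.linear scale_nsym scale_nsym2 g \<and>
     (\<forall>I. g (ribbon I) =
       (\<Sum>(H, K) | weight H = weight I \<and> weight K = weight I \<and> Des H \<inter> Des K = Des I.
          ribbon H \<otimes> ribbon K)))"

lemma
  shows linear_gamma_wedge: "Vector_Spaces.linear scale_nsym scale_nsym2 gamma_wedge"
    and gamma_wedge_ribbon: "gamma_wedge (ribbon I) =
      (\<Sum>(H, K) | weight H = weight I \<and> weight K = weight I \<and> Des H \<inter> Des K = Des I.
         ribbon H \<otimes> ribbon K)"
proof -
  let ?P = "\<lambda>g. Vector_Spaces.linear scale_nsym scale_nsym2 g \<and>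
     (\<forall>I. g (ribbon I) =
       (\<Sum>(H, K) | weight H = weight I \<and> weight K = weight I \<and> Des H \<inter> Des K = Des I.
          ribbon H \<otimes> ribbon K))"
  have "\<exists>!g. ?P g"
  proof (rule ex_ex1I)
    show "\<exists>g. ?P g" by (rule linear_extension_ribbon)
    show "g = g'" if "?P g" "?P g'" for g g'
      by (rule linear_eqI_ribbon[OF conjunct1[OF that(1)] conjunct1[OF that(2)]]) (simp add: that)
  qed
  then have "?P (THE g. ?P g)"
    by (rule theI')
  then show "Vector_Spaces.linear scale_nsym scale_nsym2 gamma_wedge"
    and "gamma_wedge (ribbon I) =
      (\<Sum>(H, K) | weight H = weight I \<and> weight K = weight I \<and> Des H \<inter> Des K = Des I.
         ribbon H \<otimes> ribbon K)"
    unfolding gamma_wedge_def by blast+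
qed

end

theory Submission
  imports Defs "HOL-Computational_Algebra.Formal_Power_Series"
begin

text \<open>
  For a composition $I$ of $n$ let $\Lambda^I$ be the product of the $\Lambda_{i}$ over the parts
  $i$ of $I$. The proof rests on the expansion of these products in ribbons: $\Lambda^I$ is the sum
  of the $R_J$ over all compositions $J$ of $n$ such that $\mathrm{Des}(J)$ contains the complement
  of $\mathrm{Des}(I)$ (\<open>Lam_prod_eq_sum_ribbon\<close>). An intersection $\mathrm{Des}(H) \cap
  \mathrm{Des}(K)$ contains a given set exactly if both $\mathrm{Des}(H)$ and $\mathrm{Des}(K)$ do,
  and every subset of $\{1, \dots, n-1\}$ is the descent set of exactly one composition of $n$.
  Applying $\gamma_\wedge$ to the expansion therefore produces each $R_H \otimes R_K$ with $H$ and
  $K$ in the index set once, so that $\gamma_\wedge(\Lambda^I) = \Lambda^I \otimes \Lambda^I$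
  (\<open>gamma_wedge_Lam_prod\<close>).

  The case of at most one part is the formula for $\gamma_\wedge(\Lambda_n)$. Since $\Lambda^I
  \Lambda^J$ is $\Lambda^{I+J}$, with $I+J$ the concatenation, $\gamma_\wedge$ is multiplicative on
  the $\Lambda^I$. These span $\mathbf{Sym}$, because the defining relation of the $\Lambda_n$
  can be solved recursively for the $S_n$; this is packaged as the induction principle
  \<open>nsym_induct_Lam\<close>, which gives multiplicativity everywhere and the uniqueness of
  $\gamma_\wedge$.

  For the inversion formula, $S_n$ is the ribbon with empty descent set, so the component of degree
  $n$ of the right-hand side is $\gamma_\wedge(S_n)$. Applying $\gamma_\wedge$ to
  $\sum_k (-1)^k \Lambda_k S_{n-k} = 0$ for $n \geq 1$ shows that the two series, regarded as formal power series
  in an auxiliary variable that records the degree, have product $1$. A right inverse of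
  a power series with constant term $1$ is also a left inverse; summing the homogeneous components in
  the completion turns these identities into those of the theorem.
\<close>

section \<open>Partial sums of compositions\<close>

definition row :: "nat \<Rightarrow> composition" where
  "row n = (if n = 0 then 0 else Composition [n])"

text \<open>The descent set together with its two trivial elements, $0$ and the weight. Under concatenation
  these sets behave uniformly (\<open>psums_plus\<close>), whereas descent sets need a case distinction on
  empty factors.\<close>

definition psums :: "composition \<Rightarrow> nat set" where
  "psums I = {weight u |u v. u + v = I}"

lemma parts_zero [simp]: "parts 0 = []"
  by (rule zero_composition.rep_eq)

lemma parts_row: "parts (row n) = (if n = 0 then [] else [n])"
  by (simp add: row_def Composition_inverse)

lemma weight_zero [simp]: "weight 0 = 0"
  by (simp add: weight_def)

lemma weight_plus [simp]: "weight (I + J) = weight I + weight J"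
  by (simp add: weight_def plus_composition.rep_eq)

lemma weight_row [simp]: "weight (row n) = n"
  by (simp add: weight_def parts_row)

lemma len_zero [simp]: "len 0 = 0"
  by (simp add: len_def)

lemma len_plus [simp]: "len (I + J) = len I + len J"
  by (simp add: len_def plus_composition.rep_eq)

lemma len_row [simp]: "len (row n) = (if n = 0 then 0 else 1)"
  by (simp add: len_def parts_row)

lemma sum_list_eq_0_imp_Nil: "0 \<notin> set xs \<Longrightarrow> sum_list xs = 0 \<Longrightarrow> xs = ([] :: nat list)"
  by (cases xs) auto

lemma weight_eq_0_iff [simp]: "weight I = 0 \<longleftrightarrow> I = 0"
  using sum_list_eq_0_imp_Nil[OF zero_notin_parts, of I]
  by (auto simp: weight_def parts_eq_iff[symmetric])

lemma composition_cases:
  obtains (zero) "I = 0" | (row_plus) m J where "m > 0" "I = row m + J"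
proof (cases "parts I")
  case Nil
  then have "I = 0" by (simp add: parts_eq_iff[symmetric])
  then show ?thesis by (rule zero)
next
  case (Cons m xs)
  then have xs: "m > 0" "0 \<notin> set xs" using zero_notin_parts[of I] by auto
  then have "I = row m + Composition xs"
    by (simp add: parts_eq_iff[symmetric] Cons plus_composition.rep_eq parts_row Composition_inverse)
  with xs show ?thesis by (intro row_plus)
qed

lemma composition_rev_cases:
  obtains (zero) "I = 0" | (plus_row) m J where "m > 0" "I = J + row m"
proof (cases "parts I" rule: rev_cases)
  case Nil
  then have "I = 0" by (simp add: parts_eq_iff[symmetric])
  then show ?thesis by (rule zero)
next
  case (snoc xs m)
  then have xs: "m > 0" "0 \<notin> set xs" using zero_notin_parts[of I] by auto
  then have "I = Composition xs + row m"
    by (simp add: parts_eq_iff[symmetric] snoc plus_composition.rep_eq parts_row Composition_inverse)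
  with xs show ?thesis by (intro plus_row)
qed

lemma composition_induct [case_names zero row_plus]:
  assumes "P 0" "\<And>m I. m > 0 \<Longrightarrow> P I \<Longrightarrow> P (row m + I)"
  shows "P I"
proof (induction "weight I" arbitrary: I rule: less_induct)
  case less
  show ?case
    by (cases I rule: composition_cases) (use assms less in auto)
qed

text \<open>Of two left factors of the same composition one is a prefix of the other, and what it lacks has
  weight $0$, hence is empty.\<close>

lemma splitting_unique:
  assumes "u + v = u' + v'" "weight u = weight u'"
  shows "u = u'" "v = v'"
proof -
  have "parts u @ parts v = parts u' @ parts v'"
    using assms(1) by (simp flip: plus_composition.rep_eq)
  moreover have "ys = []" if "xs @ ys = parts w" "sum_list xs = weight w" for xs ys w
  proof -
    have "0 \<notin> set ys" using zero_notin_parts[of w] that(1) by (metis UnCI set_append)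
    moreover have "sum_list ys = 0" using that by (simp add: weight_def flip: that(1))
    ultimately show ?thesis by (rule sum_list_eq_0_imp_Nil)
  qed
  moreover note this[of "parts u" _ u'] this[of "parts u'" _ u]
  ultimately have "parts u = parts u' \<and> parts v = parts v'"
    unfolding append_eq_append_conv2 using assms(2) unfolding weight_def by (metis append_Nil append_Nil2)
  then show "u = u'" "v = v'" by (simp_all add: parts_eq_iff)
qed

lemma psumsI: "weight u \<in> psums (u + v)"
  by (auto simp: psums_def)

lemma zero_in_psums [simp]: "0 \<in> psums I"
  using psumsI[of 0 I] by simp

lemma weight_in_psums [simp]: "weight I \<in> psums I"
  using psumsI[of I 0] by simp

lemma psums_le: "k \<in> psums I \<Longrightarrow> k \<le> weight I"
  by (auto simp: psums_def)

lemma finite_psums [simp]: "finite (psums I)"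
  by (rule finite_subset[of _ "{..weight I}"]) (auto simp: psums_le)

lemma psums_plus: "psums (I + J) = psums I \<union> (+) (weight I) ` psums J"
proof (intro equalityI subsetI)
  fix k
  assume "k \<in> psums (I + J)"
  then obtain u v where k: "k = weight u" and eq: "u + v = I + J"
    by (auto simp: psums_def)
  have no0: "0 \<notin> set ys" if "xs @ ys = parts w \<or> ys @ xs = parts w" for xs ys w
    using zero_notin_parts[of w] that by (metis UnCI set_append)
  from eq have "parts u @ parts v = parts I @ parts J"
    by (simp flip: plus_composition.rep_eq)
  then consider (left) w where "parts u @ w = parts I"
    | (right) w where "parts u = parts I @ w" "w @ parts v = parts J"
    by (auto simp: append_eq_append_conv2)
  then show "k \<in> psums I \<union> (+) (weight I) ` psums J"
  proof cases
    case left
    with no0[of "parts u" w I] have "I = u + Composition w"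
      by (simp add: parts_eq_iff[symmetric] plus_composition.rep_eq Composition_inverse)
    then show ?thesis using psumsI k by simp
  next
    case right
    with no0[of "parts v" w J] have "u = I + Composition w" "J = Composition w + v"
      by (simp_all add: parts_eq_iff[symmetric] plus_composition.rep_eq Composition_inverse)
    then show ?thesis using psumsI k by simp
  qed
next
  fix k
  assume "k \<in> psums I \<union> (+) (weight I) ` psums J"
  then show "k \<in> psums (I + J)"
  proof
    assume "k \<in> psums I"
    then show ?thesis by (auto simp: psums_def) (metis add.assoc)
  next
    assume "k \<in> (+) (weight I) ` psums J"
    then show ?thesis by (auto simp: psums_def) (metis add.assoc weight_plus)
  qed
qed

lemma psums_zero [simp]: "psums 0 = {0}"
  using psums_le[of _ 0] by auto

lemma psums_row [simp]: "psums (row n) = {0, n}"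
proof -
  have "k = 0 \<or> k = n" if "k \<in> psums (row n)" for k
  proof -
    from that obtain u v where k: "k = weight u" and "u + v = row n" by (auto simp: psums_def)
    then have "parts u @ parts v = parts (row n)" by (simp flip: plus_composition.rep_eq)
    then show ?thesis by (auto simp: k weight_def parts_row append_eq_Cons_conv split: if_splits)
  qed
  then show ?thesis using zero_in_psums weight_in_psums[of "row n"] by auto
qed

lemma card_psums: "card (psums I) = Suc (len I)"
proof (induction I rule: composition_induct)
  case (row_plus m I)
  have "psums (row m + I) = insert 0 ((+) m ` psums I)"
    by (auto simp: psums_plus image_iff intro: bexI[of _ 0])
  moreover have "0 \<notin> (+) m ` psums I" using row_plus by auto
  ultimately show ?case using row_plus by (simp add: card_image)
qed simp

lemma Des_eq_psums: "Des I = psums I - {0, weight I}"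
proof (intro equalityI subsetI)
  fix d
  assume "d \<in> Des I"
  then obtain k where k: "0 < k" "k < len I" "d = sum_list (take k (parts I))"
    by (auto simp: Des_def)
  have no0: "0 \<notin> set (take k (parts I))" "0 \<notin> set (drop k (parts I))"
    using zero_notin_parts[of I] by (auto dest: in_set_takeD in_set_dropD)
  define u v where "u = Composition (take k (parts I))" and "v = Composition (drop k (parts I))"
  have uv: "I = u + v"
    by (simp add: u_def v_def parts_eq_iff[symmetric] plus_composition.rep_eq Composition_inverse no0)
  have d: "d = weight u"
    by (simp add: u_def weight_def Composition_inverse no0 k)
  have "u \<noteq> 0" "v \<noteq> 0"
    using k no0 by (auto simp: u_def v_def parts_eq_iff[symmetric] Composition_inverse len_def)
  then show "d \<in> psums I - {0, weight I}"
    using psumsI[of u v] by (simp add: d uv)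
next
  fix d
  assume d: "d \<in> psums I - {0, weight I}"
  then obtain u v where uv: "d = weight u" "I = u + v"
    by (auto simp: psums_def)
  with d have "u \<noteq> 0" "v \<noteq> 0" by auto
  then have "0 < len u" "len u < len I"
    by (auto simp: uv(2) len_def plus_composition.rep_eq parts_eq_iff[symmetric])
  then show "d \<in> Des I"
    unfolding Des_def
    by (intro CollectI exI[of _ "len u"])
       (simp add: uv plus_composition.rep_eq weight_def len_def)
qed

lemma Des_subset_iff: "weight I = weight J \<Longrightarrow> Des I \<subseteq> Des J \<longleftrightarrow> psums I \<subseteq> psums J"
  by (auto simp: Des_eq_psums)

lemma Des_Int_eq_iff:
  assumes "weight H = weight I" "weight K = weight I"
  shows "Des H \<inter> Des K = Des I \<longleftrightarrow> psums H \<inter> psums K = psums I"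
  using assms zero_in_psums[of H] zero_in_psums[of I] zero_in_psums[of K]
    weight_in_psums[of H] weight_in_psums[of I] weight_in_psums[of K]
  unfolding Des_eq_psums by (auto simp del: zero_in_psums weight_in_psums)

lemma psums_inj: "weight I = weight J \<Longrightarrow> psums I = psums J \<Longrightarrow> I = J"
  by (rule Des_inj) (simp_all add: Des_eq_psums)

text \<open>Together with \<open>psums_inj\<close> this is the bijection between the compositions of $n$ and the
  subsets of $\{1, \dots, n-1\}$.\<close>

lemma ex_psums:
  assumes "0 \<in> A" "n \<in> A" "A \<subseteq> {..n}"
  shows "\<exists>I. weight I = n \<and> psums I = A"
  using assms
proof (induction n arbitrary: A rule: less_induct)
  case (less n)
  show ?case
  proof (cases "n = 0")
    case True
    then show ?thesis using less.prems by (intro exI[of _ 0]) auto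
  next
    case False
    \<comment> \<open>The last part of the composition is the gap between the two largest elements of A.\<close>
    define m where "m = Max (A - {n})"
    have fin: "finite (A - {n})" using less.prems finite_subset by auto
    have "m \<in> A - {n}" unfolding m_def using fin less.prems False by (intro Max_in) auto
    then have m: "m \<in> A" "m < n" using less.prems by force+
    have le: "k \<le> m" if "k \<in> A - {n}" for k unfolding m_def using fin that by (rule Max_ge)
    obtain I where I: "weight I = m" "psums I = A - {n}"
      using less.IH[of m "A - {n}"] m less.prems False le by auto
    have "psums (I + row (n - m)) = A"
      using I m less.prems by (auto simp: psums_plus)
    then show ?thesis using I m by (intro exI[of _ "I + row (n - m)"]) auto
  qed
qed


section \<open>Products of elementary functions\<close>

lemma S_eq_single: "S n = Poly_Mapping.single (row n) 1"
  by (simp add: S_def row_def flip: single_one)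

definition refinements :: "composition \<Rightarrow> composition set" where
  "refinements I = {K. weight K = weight I \<and> psums I \<subseteq> psums K}"

text \<open>The product of the \<open>Lam i\<close> over the parts \<open>i\<close> of \<open>I\<close>, already expanded in the products of the
  complete functions: see \<open>Lam_prod_plus\<close> and \<open>Lam_eq_Lam_prod\<close>. The sign is that of
  $|I| - l(K)$, written as a sum to avoid subtraction of natural numbers.\<close>

definition Lam_prod :: "composition \<Rightarrow> nsym" where
  "Lam_prod I = (\<Sum>K\<in>refinements I. Poly_Mapping.single K ((-1) ^ (weight I + len K)))"

lemma finite_refinements [simp]: "finite (refinements I)"
  unfolding refinements_def by (rule finite_subset[OF _ finite_weight_eq[of "weight I"]]) auto

lemma refinements_plus_iff:
  assumes "weight u = weight I" "weight v = weight J"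
  shows "psums (I + J) \<subseteq> psums (u + v) \<longleftrightarrow> psums I \<subseteq> psums u \<and> psums J \<subseteq> psums v"
proof
  assume L: "psums (I + J) \<subseteq> psums (u + v)"
  show "psums I \<subseteq> psums u \<and> psums J \<subseteq> psums v"
  proof (intro conjI subsetI)
    fix k assume k: "k \<in> psums I"
    then have "k \<in> psums u \<union> (+) (weight I) ` psums v"
      using L assms by (auto simp: psums_plus)
    then show "k \<in> psums u" using psums_le[OF k] assms weight_in_psums[of u] by auto
  next
    fix k assume k: "k \<in> psums J"
    then have "weight I + k \<in> psums u \<union> (+) (weight I) ` psums v"
      using L assms by (auto simp: psums_plus)
    then show "k \<in> psums v" using psums_le[of "weight I + k" u] assms by auto
  qed
qed (use assms in \<open>auto simp: psums_plus\<close>)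

text \<open>A refinement of \<open>I + J\<close> has a partial sum \<open>weight I\<close>, at which it splits uniquely into a
  refinement of \<open>I\<close> and a refinement of \<open>J\<close>.\<close>

lemma Lam_prod_plus: "Lam_prod (I + J) = Lam_prod I * Lam_prod J"
proof -
  have bij: "bij_betw (\<lambda>(u, v). u + v) (refinements I \<times> refinements J) (refinements (I + J))"
    unfolding bij_betw_def
  proof
    show "inj_on (\<lambda>(u, v). u + v) (refinements I \<times> refinements J)"
      by (auto simp: inj_on_def refinements_def dest: splitting_unique)
    show "(\<lambda>(u, v). u + v) ` (refinements I \<times> refinements J) = refinements (I + J)"
    proof (intro equalityI subsetI)
      fix K assume "K \<in> (\<lambda>(u, v). u + v) ` (refinements I \<times> refinements J)"
      then show "K \<in> refinements (I + J)"
        by (clarsimp simp: refinements_def refinements_plus_iff)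
    next
      fix K assume K: "K \<in> refinements (I + J)"
      then have "weight I \<in> psums K" by (auto simp: refinements_def psums_plus)
      then obtain u v where uv: "weight u = weight I" "K = u + v" by (auto simp: psums_def)
      with K have "u \<in> refinements I \<and> v \<in> refinements J"
        using refinements_plus_iff[of u I v J] by (auto simp: refinements_def)
      with uv show "K \<in> (\<lambda>(u, v). u + v) ` (refinements I \<times> refinements J)" by auto
    qed
  qed
  have "Lam_prod (I + J) = (\<Sum>(u, v)\<in>refinements I \<times> refinements J.
      Poly_Mapping.single (u + v) ((-1) ^ (weight (I + J) + len (u + v))))"
    unfolding Lam_prod_def by (subst sum.reindex_bij_betw[OF bij, symmetric]) (simp add: case_prod_beta')
  also have "\<dots> = (\<Sum>(u, v)\<in>refinements I \<times> refinements J.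
      Poly_Mapping.single u ((-1) ^ (weight I + len u)) * Poly_Mapping.single v ((-1) ^ (weight J + len v)))"
    by (intro sum.cong) (auto simp: mult_single power_add mult_ac)
  also have "\<dots> = Lam_prod I * Lam_prod J"
    by (simp add: Lam_prod_def sum_product sum.cartesian_product)
  finally show ?thesis .
qed

text \<open>The recursion for \<open>Lam n\<close> splits off the last part of the composition \<open>K\<close>.\<close>

lemma Lam_eq_sum: "Lam n = (\<Sum>K | weight K = n. Poly_Mapping.single K ((-1) ^ (n + len K)))"
proof (induction n rule: less_induct)
  case (less n)
  show ?case
  proof (cases n)
    case 0
    then show ?thesis by simp
  next
    case (Suc m)
    have sgn: "((-1) ^ p :: nsym) = Poly_Mapping.single 0 ((-1) ^ p)" for p
      by (induction p) (simp_all add: single_uminus[symmetric] mult_single flip: single_one)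
    have sign: "(-1 :: complex) ^ (m + k) * (-1) ^ (k + l) = (-1) ^ (m + l)" for k l
      by (simp add: power_add mult_ac flip: power_mult_distrib)
    have "Lam n = (\<Sum>k\<le>m. \<Sum>K | weight K = k.
        Poly_Mapping.single (K + row (Suc m - k)) ((-1) ^ (m + k) * (-1) ^ (k + len K)))"
      using less.IH Suc
      by (simp add: sgn S_eq_single sum_distrib_left sum_distrib_right mult_single)
    also have "\<dots> = (\<Sum>(k, K)\<in>Sigma {..m} (\<lambda>k. {K. weight K = k}).
        Poly_Mapping.single (K + row (Suc m - k)) ((-1) ^ (m + k) * (-1) ^ (k + len K)))"
      by (rule sum.Sigma) auto
    also have "\<dots> = (\<Sum>(k, K)\<in>Sigma {..m} (\<lambda>k. {K. weight K = k}).
        Poly_Mapping.single (K + row (Suc m - k)) ((-1) ^ (n + len (K + row (Suc m - k)))))"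
      by (intro sum.cong refl) (auto simp: Suc sign)
    also have "\<dots> = (\<Sum>K | weight K = n. Poly_Mapping.single K ((-1) ^ (n + len K)))"
    proof -
      have "bij_betw (\<lambda>(k, K). K + row (Suc m - k)) (Sigma {..m} (\<lambda>k. {K. weight K = k})) {K. weight K = n}"
        unfolding bij_betw_def
      proof
        have "K = K'" if "K + row (Suc m - weight K) = K' + row (Suc m - weight K')"
          "weight K \<le> m" "weight K' \<le> m" for K K'
        proof -
          have p: "parts K @ [Suc m - weight K] = parts K' @ [Suc m - weight K']"
            using that by (auto simp: plus_composition.rep_eq parts_row dest!: arg_cong[of _ _ parts] split: if_splits)
          then show ?thesis by (simp add: parts_eq_iff)
        qed
        then show "inj_on (\<lambda>(k, K). K + row (Suc m - k)) (Sigma {..m} (\<lambda>k. {K. weight K = k}))"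
          by (auto simp: inj_on_def)
        show "(\<lambda>(k, K). K + row (Suc m - k)) ` (Sigma {..m} (\<lambda>k. {K. weight K = k})) = {K. weight K = n}"
        proof (intro equalityI subsetI)
          fix K assume K: "K \<in> {K. weight K = n}"
          show "K \<in> (\<lambda>(k, K). K + row (Suc m - k)) ` (Sigma {..m} (\<lambda>k. {K. weight K = k}))"
          proof (cases K rule: composition_rev_cases)
            case zero
            then show ?thesis using K Suc by simp
          next
            case (plus_row p J)
            then have "p = Suc m - weight J" using K Suc by auto
            then show ?thesis using plus_row K Suc
              by (intro image_eqI[of _ _ "(weight J, J)"]) auto
          qed
        qed (auto simp: Suc)
      qed
      from sum.reindex_bij_betw[OF this, of "\<lambda>K. Poly_Mapping.single K ((-1) ^ (n + len K))"]
      show ?thesis by (simp only: case_prod_beta')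
    qed
    finally show ?thesis .
  qed
qed

lemma Lam_eq_Lam_prod: "Lam n = Lam_prod (row n)"
proof -
  have "refinements (row n) = {K. weight K = n}"
    by (auto simp: refinements_def)
  then show ?thesis by (simp add: Lam_prod_def Lam_eq_sum)
qed


section \<open>Expansion in ribbons\<close>

lemma ribbon_eq_sum:
  "ribbon I = (\<Sum>K | weight K = weight I \<and> psums K \<subseteq> psums I.
     Poly_Mapping.single K ((-1) ^ (len I + len K)))"
  unfolding ribbon_def
proof (intro sum.cong)
  fix K assume "K \<in> {K. weight K = weight I \<and> psums K \<subseteq> psums I}"
  then have "len K \<le> len I" using card_mono[of "psums I" "psums K"] by (simp add: card_psums)
  then obtain d where "len I = len K + d" using le_Suc_ex by blast
  then have "(-1 :: complex) ^ (len I - len K) = (-1) ^ (len I + len K)"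
    by (simp add: power_add mult_ac flip: power_mult_distrib)
  then show "scale_nsym ((-1) ^ (len I - len K)) (S_prod K) = Poly_Mapping.single K ((-1) ^ (len I + len K))"
    by (simp add: scale_nsym_def S_prod_eq_single mult_single)
qed (simp_all add: Des_subset_iff cong: conj_cong)

text \<open>Expand the product of $(-1) + 1$ over the elements of \<open>N - C\<close>.\<close>

lemma alternating_sum_interval:
  fixes N :: "'a set"
  assumes "finite N" "C \<subseteq> N"
  shows "(\<Sum>A | C \<subseteq> A \<and> A \<subseteq> N. (-1) ^ card A) = (if C = N then (-1) ^ card N else 0 :: complex)"
proof -
  have finC: "finite C" using assms finite_subset by auto
  have "(\<Sum>A | C \<subseteq> A \<and> A \<subseteq> N. (-1) ^ card A) = (\<Sum>X\<in>Pow (N - C). (-1) ^ card (C \<union> X) :: complex)"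
    by (rule sum.reindex_bij_witness[where i = "\<lambda>X. C \<union> X" and j = "\<lambda>A. A - C"])
       (use assms in \<open>auto simp: Un_absorb1\<close>)
  also have "\<dots> = (\<Sum>X\<in>Pow (N - C). (-1) ^ card C * ((-1) ^ card X))"
    using finC assms
    by (intro sum.cong refl, subst card_Un_disjoint) (auto simp: power_add intro: finite_subset)
  also have "\<dots> = (-1) ^ card C * (\<Prod>x\<in>N - C. (-1) + 1)"
    using assms by (subst prod_add) (auto simp: sum_distrib_left)
  also have "\<dots> = (if C = N then (-1) ^ card N else 0)"
    using assms by (auto simp: card_eq_0_iff power_0_left)
  finally show ?thesis .
qed

text \<open>The condition says that every element of $\{1, \dots, n-1\}$ is a descent of \<open>I\<close> or of \<open>J\<close>; the
  endpoints $0$ and $n$ always belong to both sets of partial sums.\<close>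

definition complementary :: "composition \<Rightarrow> composition set" where
  "complementary I = {J. weight J = weight I \<and> {..weight I} - psums I \<subseteq> psums J}"

lemma finite_complementary [simp]: "finite (complementary I)"
  unfolding complementary_def by (rule finite_subset[OF _ finite_weight_eq[of "weight I"]]) auto

lemma alternating_sum_psums:
  assumes "0 \<in> C" "n \<in> C" "C \<subseteq> {..n}"
  shows "(\<Sum>J | weight J = n \<and> C \<subseteq> psums J. (-1) ^ len J) = (if C = {..n} then (-1) ^ n else 0 :: complex)"
proof -
  have "bij_betw psums {J. weight J = n \<and> C \<subseteq> psums J} {A. C \<subseteq> A \<and> A \<subseteq> {..n}}"
    unfolding bij_betw_def
  proof
    show "inj_on psums {J. weight J = n \<and> C \<subseteq> psums J}"
      by (auto simp: inj_on_def intro: psums_inj)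
    show "psums ` {J. weight J = n \<and> C \<subseteq> psums J} = {A. C \<subseteq> A \<and> A \<subseteq> {..n}}"
    proof (intro equalityI subsetI)
      fix A assume A: "A \<in> {A. C \<subseteq> A \<and> A \<subseteq> {..n}}"
      then obtain J where "weight J = n" "psums J = A" using ex_psums[of A n] assms by auto
      then show "A \<in> psums ` {J. weight J = n \<and> C \<subseteq> psums J}" using A by auto
    qed (auto simp: psums_le)
  qed
  from sum.reindex_bij_betw[OF this, of "\<lambda>A. (-1 :: complex) ^ card A"]
  have "- (\<Sum>J | weight J = n \<and> C \<subseteq> psums J. (-1 :: complex) ^ len J) = (\<Sum>A | C \<subseteq> A \<and> A \<subseteq> {..n}. (-1) ^ card A)"
    by (simp add: card_psums sum_negf)
  also have "\<dots> = - (if C = {..n} then (-1) ^ n else 0)"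
    using assms by (subst alternating_sum_interval) auto
  finally show ?thesis by (simp only: neg_equal_iff_equal)
qed

text \<open>In the sum of the ribbons, the coefficient of the product of complete functions indexed by \<open>K\<close> is an
  alternating sum over all compositions whose partial sums contain those of \<open>K\<close> and everything
  outside \<open>psums I\<close>. It vanishes unless these two sets already cover $\{0, \dots, n\}$, which
  means that \<open>K\<close> refines \<open>I\<close>.\<close>

lemma Lam_prod_eq_sum_ribbon: "Lam_prod I = (\<Sum>J\<in>complementary I. ribbon J)"
proof -
  define n where "n = weight I"
  define T where "T = {..n} - psums I"
  have "(\<Sum>J\<in>complementary I. ribbon J) = (\<Sum>J\<in>complementary I. \<Sum>K | K \<in> {K. weight K = n} \<and> psums K \<subseteq> psums J.
      Poly_Mapping.single K ((-1) ^ (len J + len K)))"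
    by (intro sum.cong refl) (auto simp: ribbon_eq_sum complementary_def n_def intro!: sum.cong)
  also have "\<dots> = (\<Sum>K | weight K = n. \<Sum>J | J \<in> complementary I \<and> psums K \<subseteq> psums J.
      Poly_Mapping.single K ((-1) ^ (len J + len K)))"
    by (rule sum.swap_restrict) auto
  also have "\<dots> = (\<Sum>K | weight K = n. if psums I \<subseteq> psums K then Poly_Mapping.single K ((-1) ^ (n + len K)) else 0)"
  proof (intro sum.cong refl)
    fix K assume K: "K \<in> {K. weight K = n}"
    have sub: "T \<union> psums K \<subseteq> {..n}" using K psums_le by (auto simp: T_def)
    have single_sum: "(\<Sum>x\<in>A. Poly_Mapping.single K (f x)) = Poly_Mapping.single K (sum f A)"
      for A :: "composition set" and f :: "_ \<Rightarrow> complex"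
      by (induction A rule: infinite_finite_induct) (simp_all add: single_add)
    have "(\<Sum>J | J \<in> complementary I \<and> psums K \<subseteq> psums J. Poly_Mapping.single K ((-1) ^ (len J + len K)))
        = Poly_Mapping.single K ((\<Sum>J | J \<in> complementary I \<and> psums K \<subseteq> psums J. (-1) ^ len J) * (-1 :: complex) ^ len K)"
      by (simp add: single_sum power_add sum_distrib_right)
    also have complementary_eq: "{J. J \<in> complementary I \<and> psums K \<subseteq> psums J} = {J. weight J = n \<and> T \<union> psums K \<subseteq> psums J}"
      by (auto simp: complementary_def n_def T_def)
    also have "(\<Sum>J | weight J = n \<and> T \<union> psums K \<subseteq> psums J. (-1) ^ len J)
        = (if T \<union> psums K = {..n} then (-1) ^ n else 0 :: complex)"
      using K weight_in_psums[of K] by (intro alternating_sum_psums sub) auto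
    also have "T \<union> psums K = {..n} \<longleftrightarrow> psums I \<subseteq> psums K"
      using sub psums_le[of _ I] by (auto simp: T_def n_def)
    also have "Poly_Mapping.single K ((if psums I \<subseteq> psums K then (-1) ^ n else 0) * (-1 :: complex) ^ len K)
        = (if psums I \<subseteq> psums K then Poly_Mapping.single K ((-1) ^ (n + len K)) else 0)"
      by (simp add: power_add)
    finally show "(\<Sum>J | J \<in> complementary I \<and> psums K \<subseteq> psums J. Poly_Mapping.single K ((-1 :: complex) ^ (len J + len K)))
        = (if psums I \<subseteq> psums K then Poly_Mapping.single K ((-1) ^ (n + len K)) else 0)"
      unfolding complementary_eq .
  qed
  also have "\<dots> = Lam_prod I"
    unfolding Lam_prod_def refinements_def n_def
    by (subst sum.inter_filter[symmetric]) auto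
  finally show ?thesis by simp
qed

lemma ribbon_row: "ribbon (row n) = S n"
proof -
  have "{K. weight K = n \<and> psums K \<subseteq> {0, n}} = {row n}"
    by (auto intro!: psums_inj)
  then show ?thesis by (simp add: ribbon_eq_sum S_eq_single flip: mult_2)
qed


section \<open>Coefficients of tensors\<close>

lemma coeff_zero [simp]: "coeff 0 p = 0"
  by (simp add: zero_nsym2.rep_eq)

lemma coeff_sum: "coeff (\<Sum>i\<in>A. f i) p = (\<Sum>i\<in>A. coeff (f i) p)"
  by (induction A rule: infinite_finite_induct) (simp_all add: plus_nsym2.rep_eq)

lemma tensor_sum_sum: "(\<Sum>i\<in>A. f i) \<otimes> (\<Sum>j\<in>B. g j) = (\<Sum>(i, j)\<in>A \<times> B. f i \<otimes> g j)"
proof (rule nsym2_eqI)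
  fix H K
  show "coeff ((\<Sum>i\<in>A. f i) \<otimes> (\<Sum>j\<in>B. g j)) (H, K) = coeff (\<Sum>(i, j)\<in>A \<times> B. f i \<otimes> g j) (H, K)"
    by (simp add: coeff_sum lookup_sum sum_product sum.cartesian_product case_prod_beta')
qed

lemma tensor_one: "1 \<otimes> 1 = 1"
  by (rule nsym2_eqI)
     (auto simp: one_nsym2.rep_eq lookup_one when_def zero_prod_def)


section \<open>Multiplicativity\<close>

interpretation gamma_wedge: Vector_Spaces.linear scale_nsym scale_nsym2 gamma_wedge
  by (rule linear_gamma_wedge)

text \<open>The pairs with both entries in \<open>complementary I\<close> are grouped by the intersection of their
  descent sets. That intersection again contains the complement of the descents of \<open>I\<close>, so each
  group is the image of exactly one ribbon of the expansion of \<open>Lam_prod I\<close>.\<close>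

lemma gamma_wedge_Lam_prod: "gamma_wedge (Lam_prod I) = Lam_prod I \<otimes> Lam_prod I"
proof -
  define n where "n = weight I"
  let ?C = "complementary I"
  let ?cap = "\<lambda>(H, K). psums H \<inter> psums K"
  have inj: "inj_on psums ?C"
    by (auto simp: inj_on_def complementary_def intro: psums_inj)
  have closed: "?cap ` (?C \<times> ?C) \<subseteq> psums ` ?C"
  proof clarify
    fix H K assume HK: "H \<in> ?C" "K \<in> ?C"
    then have w: "weight H = n" "weight K = n" by (simp_all add: complementary_def n_def)
    then have "n \<in> psums H \<inter> psums K" using weight_in_psums[of H] weight_in_psums[of K] by simp
    then obtain J where J: "weight J = n" "psums J = psums H \<inter> psums K"
      using ex_psums[of "psums H \<inter> psums K" n] w psums_le by fastforce
    with HK have "J \<in> ?C" by (auto simp: complementary_def n_def)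
    with J show "psums H \<inter> psums K \<in> psums ` ?C" by (metis imageI)
  qed
  have "gamma_wedge (Lam_prod I) = (\<Sum>J\<in>?C. gamma_wedge (ribbon J))"
    by (simp add: Lam_prod_eq_sum_ribbon gamma_wedge.sum)
  also have "\<dots> = (\<Sum>J\<in>?C. \<Sum>(H, K)\<in>{p \<in> ?C \<times> ?C. ?cap p = psums J}. ribbon H \<otimes> ribbon K)"
    unfolding gamma_wedge_ribbon
  proof (intro sum.cong refl set_eqI, clarify)
    fix J H K assume J: "J \<in> ?C"
    show "(H, K) \<in> {(H, K). weight H = weight J \<and> weight K = weight J \<and> Des H \<inter> Des K = Des J} \<longleftrightarrow>
        (H, K) \<in> {p \<in> ?C \<times> ?C. ?cap p = psums J}"
    proof (cases "weight H = weight J \<and> weight K = weight J")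
      case True
      with J show ?thesis by (simp add: Des_Int_eq_iff complementary_def) blast
    qed (use J in \<open>auto simp: complementary_def\<close>)
  qed
  also have "\<dots> = (\<Sum>X\<in>psums ` ?C. \<Sum>(H, K)\<in>{p \<in> ?C \<times> ?C. ?cap p = X}. ribbon H \<otimes> ribbon K)"
    by (simp add: sum.reindex[OF inj])
  also have "\<dots> = (\<Sum>(H, K)\<in>?C \<times> ?C. ribbon H \<otimes> ribbon K)"
    using closed by (intro sum.group) auto
  also have "\<dots> = Lam_prod I \<otimes> Lam_prod I"
    by (simp add: Lam_prod_eq_sum_ribbon tensor_sum_sum)
  finally show ?thesis .
qed

lemma gamma_wedge_Lam: "gamma_wedge (Lam n) = Lam n \<otimes> Lam n"
  by (simp add: Lam_eq_Lam_prod gamma_wedge_Lam_prod)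

lemma gamma_wedge_one: "gamma_wedge 1 = 1"
  using gamma_wedge_Lam[of 0] by (simp add: tensor_one)

lemma scale_nsym_mult_left: "scale_nsym c (F * G) = scale_nsym c F * G"
  by (simp add: scale_nsym_def mult.assoc)

lemma scale_nsym_mult_right: "scale_nsym c (F * G) = F * scale_nsym c G"
proof -
  have "Poly_Mapping.single 0 c * F = F * Poly_Mapping.single 0 c"
  proof (rule poly_mapping_eqI)
    fix I
    have "Poly_Mapping.lookup (F * Poly_Mapping.single 0 c) I =
        (\<Sum>(u, v) | u + v = I. Poly_Mapping.lookup F u * (if v = 0 then c else 0))"
      unfolding lookup_mult_nsym by (intro sum.cong refl) (auto simp: lookup_single when_def)
    also have "\<dots> = (\<Sum>(u, v) \<in> {(I, 0 :: composition)}. Poly_Mapping.lookup F u * (if v = 0 then c else 0))"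
      by (rule sum.mono_neutral_right) (auto split: if_splits)
    finally show "Poly_Mapping.lookup (Poly_Mapping.single 0 c * F) I
        = Poly_Mapping.lookup (F * Poly_Mapping.single 0 c) I"
      using lookup_scale_nsym[of c F I] by (simp add: scale_nsym_def mult.commute)
  qed
  then show ?thesis by (simp add: scale_nsym_def flip: mult.assoc)
qed

lemma scale_nsym2_mult_left: "scale_nsym2 c (x * y) = scale_nsym2 c x * y"
  by transfer (auto simp: fun_eq_iff sum_distrib_left mult.assoc case_prod_beta')

lemma scale_nsym2_mult_right: "scale_nsym2 c (x * y) = x * scale_nsym2 c y"
  by transfer (auto simp: fun_eq_iff sum_distrib_left mult_ac case_prod_beta')

text \<open>Words in the elementary functions span: the elements that preserve \<open>P\<close> under left multiplication
  form a subalgebra, which contains the \<open>Lam n\<close> and, by the relation between the two families,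
  also the free generators \<open>S n\<close>.\<close>

lemma nsym_induct_Lam [case_names one Lam add scale]:
  assumes one: "P 1"
    and Lam: "\<And>n F. P F \<Longrightarrow> P (Lam n * F)"
    and add: "\<And>F G. P F \<Longrightarrow> P G \<Longrightarrow> P (F + G)"
    and scale: "\<And>c F. P F \<Longrightarrow> P (scale_nsym c F)"
  shows "P F"
proof -
  define Q where "Q A \<longleftrightarrow> (\<forall>F. P F \<longrightarrow> P (A * F))" for A
  have Q_add: "Q (A + B)" if "Q A" "Q B" for A B
    using that add by (auto simp: Q_def distrib_right)
  have Q_scale: "Q (scale_nsym c A)" if "Q A" for c A
    using that scale by (auto simp: Q_def simp flip: scale_nsym_mult_left)
  have Q_mult: "Q (A * B)" if "Q A" "Q B" for A B
    using that by (auto simp: Q_def mult.assoc)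
  have Q_one: "Q 1" by (simp add: Q_def)
  have Q_Lam: "Q (Lam n)" for n using Lam by (simp add: Q_def)
  have uminus_eq: "- A = scale_nsym (-1) A" for A
    by (rule poly_mapping_eqI) (simp add: lookup_scale_nsym)
  have Q_uminus: "Q (- A)" if "Q A" for A
    using Q_scale[OF that, of "-1"] by (simp only: uminus_eq)
  have Q_zero: "Q 0"
    using Q_add[OF Q_one Q_uminus[OF Q_one]] by (simp only: right_minus)
  have Q_sum: "Q (\<Sum>i\<in>A. f i)" if "\<And>i. i \<in> A \<Longrightarrow> Q (f i)" for A and f :: "'i \<Rightarrow> nsym"
    using that by (induction A rule: infinite_finite_induct) (auto intro: Q_add Q_zero)
  have Q_sign: "Q ((-1) ^ k)" for k
    by (induction k) (auto intro: Q_one Q_uminus)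
  have Q_S: "Q (S n)" for n
  proof (induction n rule: less_induct)
    case (less n)
    show ?case
    proof (cases "n = 0")
      case True
      then show ?thesis using Q_one by (simp add: S_def)
    next
      case False
      then have "0 = (\<Sum>k\<le>n. (-1) ^ k * Lam k * S (n - k))"
        using Lam_S_relation[of n] by simp
      also have "{..n} = insert 0 {1..n}" by auto
      finally have "S n = - (\<Sum>k=1..n. (-1) ^ k * Lam k * S (n - k))"
        by (simp add: eq_neg_iff_add_eq_0)
      then show ?thesis
        using less False by (auto intro!: Q_uminus Q_sum Q_mult Q_sign Q_Lam)
    qed
  qed
  have "Q (prod_list (map S xs))" for xs
    by (induction xs) (auto intro: Q_mult Q_S Q_one)
  then have "Q (S_prod I)" for I by (simp add: S_prod_def)
  then have "Q F"
    by (subst nsym_expansion) (intro Q_sum Q_scale)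
  then show ?thesis using one by (auto simp: Q_def)
qed

text \<open>Multiplicativity with a word in the elementary functions on the left. The word must be
  arbitrary, rather than a single \<open>Lam n\<close>, because the induction on \<open>F\<close> moves letters from \<open>F\<close> to
  the end of the word.\<close>

lemma gamma_wedge_Lam_prod_mult: "gamma_wedge (Lam_prod I * F) = gamma_wedge (Lam_prod I) * gamma_wedge F"
proof (induction F arbitrary: I rule: nsym_induct_Lam)
  case one
  then show ?case by (simp add: gamma_wedge_one)
next
  case (Lam n F)
  have "gamma_wedge (Lam_prod I * (Lam n * F)) = gamma_wedge (Lam_prod (I + row n) * F)"
    by (simp add: Lam_prod_plus Lam_eq_Lam_prod mult.assoc)
  also have "\<dots> = gamma_wedge (Lam_prod I) * (gamma_wedge (Lam_prod (row n)) * gamma_wedge F)"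
    by (simp add: Lam gamma_wedge_Lam_prod) (simp add: Lam_prod_plus tensor_mult flip: mult.assoc)
  also have "\<dots> = gamma_wedge (Lam_prod I) * gamma_wedge (Lam n * F)"
    by (simp add: Lam Lam_eq_Lam_prod)
  finally show ?case .
next
  case (add F G)
  then show ?case by (simp add: distrib_left gamma_wedge.add)
next
  case (scale c F)
  then show ?case by (simp add: gamma_wedge.scale scale_nsym2_mult_right flip: scale_nsym_mult_right)
qed

lemma gamma_wedge_mult: "gamma_wedge (F * G) = gamma_wedge F * gamma_wedge G"
proof (induction F rule: nsym_induct_Lam)
  case one
  then show ?case by (simp add: gamma_wedge_one)
next
  case (Lam n F)
  then show ?case by (simp add: Lam_eq_Lam_prod gamma_wedge_Lam_prod_mult mult.assoc)
next
  case (add F F')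
  then show ?case by (simp add: distrib_right gamma_wedge.add)
next
  case (scale c F)
  then show ?case by (simp add: gamma_wedge.scale flip: scale_nsym_mult_left scale_nsym2_mult_left)
qed

lemma linear_eqI_Lam:
  assumes g: "Vector_Spaces.linear scale_nsym s g" and h: "Vector_Spaces.linear scale_nsym s h"
    and g_mult: "\<And>F G. g (F * G) = g F * (g G :: 'a :: {ab_group_add, semigroup_mult})"
    and h_mult: "\<And>F G. h (F * G) = h F * h G"
    and eq: "\<And>n. g (Lam n) = h (Lam n)"
  shows "g = h"
proof
  interpret g: Vector_Spaces.linear scale_nsym s g by fact
  interpret h: Vector_Spaces.linear scale_nsym s h by fact
  fix F
  show "g F = h F"
  proof (induction F rule: nsym_induct_Lam)
    case one
    then show ?case using eq[of 0] by simp
  qed (simp_all add: g_mult h_mult eq g.add h.add g.scale h.scale)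
qed


section \<open>Graded families and their sums\<close>

definition homogeneous :: "nat \<Rightarrow> nsym2 \<Rightarrow> bool" where
  "homogeneous n x \<longleftrightarrow> (\<forall>H K. coeff x (H, K) \<noteq> 0 \<longrightarrow> weight H = n \<and> weight K = n)"

text \<open>The infinite sum of a sequence whose \<open>n\<close>-th member is homogeneous of degree \<open>n\<close>: only the
  member of degree \<open>weight H\<close> contributes to the coefficient at \<open>(H, K)\<close>.\<close>

definition graded_sum :: "(nat \<Rightarrow> nsym2) \<Rightarrow> nsym2" where
  "graded_sum x = Nsym2 (\<lambda>(H, K). coeff (x (weight H)) (H, K))"

lemma coeff_graded_sum: "coeff (graded_sum x) (H, K) = coeff (x (weight H)) (H, K)"
  by (simp add: graded_sum_def Nsym2_inverse)

lemma homogeneousD: "homogeneous n x \<Longrightarrow> weight H \<noteq> n \<Longrightarrow> coeff x (H, K) = 0"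
  by (auto simp: homogeneous_def)

text \<open>Up to a given total degree, a partial sum is final as soon as it contains the finitely many
  members of at most that degree.\<close>

lemma has_sum_graded:
  fixes d :: "'i \<Rightarrow> nat"
  assumes hom: "\<And>i. i \<in> A \<Longrightarrow> homogeneous (d i) (f i)"
    and fin: "\<And>n. finite {i \<in> A. d i = n}"
  shows "(f has_sum graded_sum (\<lambda>n. \<Sum>i | i \<in> A \<and> d i = n. f i)) A"
  unfolding has_sum_def tendsto_nsym2_iff
proof
  fix N
  have "{i \<in> A. d i \<le> N} = (\<Union>n\<le>N. {i \<in> A. d i = n})" by auto
  then have finN: "finite {i \<in> A. d i \<le> N}" using fin by simp
  show "\<forall>\<^sub>F B in finite_subsets_at_top A.
      agree_upto N (sum f B) (graded_sum (\<lambda>n. \<Sum>i | i \<in> A \<and> d i = n. f i))"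
    unfolding eventually_finite_subsets_at_top
  proof (intro exI[of _ "{i \<in> A. d i \<le> N}"] conjI allI impI finN)
    fix B
    assume B: "finite B \<and> {i \<in> A. d i \<le> N} \<subseteq> B \<and> B \<subseteq> A"
    show "agree_upto N (sum f B) (graded_sum (\<lambda>n. \<Sum>i | i \<in> A \<and> d i = n. f i))"
      unfolding agree_upto_def
    proof (intro allI impI)
      fix H K
      assume "weight H + weight K \<le> N"
      then have "(\<Sum>i\<in>B. coeff (f i) (H, K)) = (\<Sum>i | i \<in> A \<and> d i = weight H. coeff (f i) (H, K))"
        using B hom by (intro sum.mono_neutral_right) (auto intro!: homogeneousD)
      then show "coeff (sum f B) (H, K) = coeff (graded_sum (\<lambda>n. \<Sum>i | i \<in> A \<and> d i = n. f i)) (H, K)"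
        by (simp add: coeff_graded_sum coeff_sum)
    qed
  qed auto
qed

text \<open>Power series with coefficients in the completed tensor square do the bookkeeping of degrees: for
  homogeneous components, the product in the completion is the Cauchy product.\<close>

lemma graded_sum_fps_mult:
  fixes a b :: "nsym2 fps"
  assumes "\<And>n. homogeneous n (fps_nth a n)" "\<And>n. homogeneous n (fps_nth b n)"
  shows "graded_sum (fps_nth a) * graded_sum (fps_nth b) = graded_sum (fps_nth (a * b))"
proof (rule nsym2_eqI)
  fix H K
  have "coeff (graded_sum (fps_nth (a * b))) (H, K) =
      (\<Sum>i=0..weight H. \<Sum>(u, v) | u + v = (H, K). coeff (fps_nth a i) u * coeff (fps_nth b (weight H - i)) v)"
    by (simp add: coeff_graded_sum fps_mult_nth coeff_sum times_nsym2.rep_eq)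
  also have "\<dots> = (\<Sum>(u, v) | u + v = (H, K). \<Sum>i=0..weight H. coeff (fps_nth a i) u * coeff (fps_nth b (weight H - i)) v)"
    by (subst sum.swap) (simp add: case_prod_beta')
  also have "\<dots> = (\<Sum>(u, v) | u + v = (H, K). coeff (graded_sum (fps_nth a)) u * coeff (graded_sum (fps_nth b)) v)"
  proof (intro sum.cong refl, clarsimp)
    fix u1 u2 v1 v2
    assume H: "H = u1 + v1"
    \<comment> \<open>By homogeneity only the component of degree \<open>weight u1\<close> contributes.\<close>
    have "(\<Sum>i=0..weight (u1 + v1). coeff (fps_nth a i) (u1, u2) * coeff (fps_nth b (weight (u1 + v1) - i)) (v1, v2))
      = (\<Sum>i\<in>{weight u1}. coeff (fps_nth a i) (u1, u2) * coeff (fps_nth b (weight (u1 + v1) - i)) (v1, v2))"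
      by (intro sum.mono_neutral_right) (auto simp: homogeneousD[OF assms(1)])
    then show "(\<Sum>i=0..weight u1 + weight v1. coeff (fps_nth a i) (u1, u2) * coeff (fps_nth b (weight u1 + weight v1 - i)) (v1, v2))
      = coeff (graded_sum (fps_nth a)) (u1, u2) * coeff (graded_sum (fps_nth b)) (v1, v2)"
      by (simp add: coeff_graded_sum)
  qed
  also have "\<dots> = coeff (graded_sum (fps_nth a) * graded_sum (fps_nth b)) (H, K)"
    by (simp add: times_nsym2.rep_eq)
  finally show "coeff (graded_sum (fps_nth a) * graded_sum (fps_nth b)) (H, K) = coeff (graded_sum (fps_nth (a * b))) (H, K)"
    by simp
qed

lemma graded_sum_one: "graded_sum (fps_nth 1) = 1"
  by (rule nsym2_eqI) (auto simp: coeff_graded_sum one_nsym2.rep_eq zero_prod_def)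

lemma fps_mult_eq_1_commute:
  fixes a b :: "'a :: ring_1 fps"
  assumes "a * b = 1" "fps_nth b 0 = 1"
  shows "b * a = 1"
proof -
  have r: "b * fps_right_inverse b 1 = 1"
    by (rule fps_right_inverse) (use assms in simp)
  have "a = a * (b * fps_right_inverse b 1)" by (simp add: r)
  also have "\<dots> = fps_right_inverse b 1" by (simp add: assms flip: mult.assoc)
  finally show ?thesis using r by simp
qed


section \<open>The inversion formula\<close>

lemma lookup_ribbon_eq_0: "weight J \<noteq> weight I \<Longrightarrow> Poly_Mapping.lookup (ribbon I) J = 0"
  by (auto simp: ribbon_eq_sum lookup_sum lookup_single when_def intro!: sum.neutral)

lemma lookup_Lam_eq_0: "weight J \<noteq> n \<Longrightarrow> Poly_Mapping.lookup (Lam n) J = 0"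
  by (auto simp: Lam_eq_sum lookup_sum lookup_single when_def intro!: sum.neutral)

lemma homogeneous_ribbon_tensor: "weight H = n \<Longrightarrow> weight K = n \<Longrightarrow> homogeneous n (ribbon H \<otimes> ribbon K)"
  by (auto simp: homogeneous_def) (metis lookup_ribbon_eq_0)+

lemma homogeneous_Lam_tensor: "homogeneous n ((-1) ^ n * (Lam n \<otimes> Lam n))"
proof -
  have "homogeneous n (Lam n \<otimes> Lam n)"
    by (auto simp: homogeneous_def) (metis lookup_Lam_eq_0)+
  moreover have "(-1) ^ n * x = x \<or> (-1) ^ n * x = - x" for x :: nsym2
    by (cases "even n") simp_all
  ultimately show ?thesis
    by (metis add.inverse_inverse homogeneous_def neg_equal_0_iff_equal uminus_nsym2.rep_eq)
qed

lemma homogeneous_sum: "(\<And>i. i \<in> A \<Longrightarrow> homogeneous n (f i)) \<Longrightarrow> homogeneous n (sum f A)"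
  unfolding homogeneous_def coeff_sum by (metis (mono_tags, lifting) sum.neutral)

lemma gamma_wedge_S: "gamma_wedge (S n) =
    (\<Sum>(H, K) | weight H = n \<and> weight K = n \<and> Des H \<inter> Des K = {}. ribbon H \<otimes> ribbon K)"
proof -
  have "Des (row n) = {}" by (auto simp: Des_eq_psums)
  then show ?thesis using gamma_wedge_ribbon[of "row n"] by (simp add: ribbon_row)
qed

lemma gamma_wedge_sign: "gamma_wedge ((-1) ^ k) = (-1) ^ k"
  by (induction k) (simp_all add: gamma_wedge.neg gamma_wedge_one)


theorem theorem3p1:
  shows "(\<forall>F G. gamma_wedge (F * G) = gamma_wedge F * gamma_wedge G) \<and>
    (\<forall>n. gamma_wedge (Lam n) = Lam n \<otimes> Lam n) \<and>
    (\<forall>g. Vector_Spaces.linear scale_nsym scale_nsym2 g \<longrightarrow>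
       (\<forall>F G. g (F * G) = g F * g G) \<longrightarrow>
       (\<forall>n. g (Lam n) = gamma_wedge (Lam n)) \<longrightarrow> g = gamma_wedge) \<and>
    (\<lambda>n. (-1) ^ n * (Lam n \<otimes> Lam n)) summable_on UNIV \<and>
    (\<lambda>(H, K). ribbon H \<otimes> ribbon K) summable_on
      {(H, K). weight H = weight K \<and> Des H \<inter> Des K = {}} \<and>
    (\<Sum>\<^sub>\<infinity>n. (-1) ^ n * (Lam n \<otimes> Lam n)) *
      (\<Sum>\<^sub>\<infinity>(H, K)\<in>{(H, K). weight H = weight K \<and> Des H \<inter> Des K = {}}. ribbon H \<otimes> ribbon K) = 1 \<and>
    (\<Sum>\<^sub>\<infinity>(H, K)\<in>{(H, K). weight H = weight K \<and> Des H \<inter> Des K = {}}. ribbon H \<otimes> ribbon K) *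
      (\<Sum>\<^sub>\<infinity>n. (-1) ^ n * (Lam n \<otimes> Lam n)) = 1"
proof -
  let ?L = "\<lambda>n. (-1) ^ n * (Lam n \<otimes> Lam n)"
  let ?A = "{(H, K). weight H = weight K \<and> Des H \<inter> Des K = {}}"
  let ?R = "\<lambda>(H, K). ribbon H \<otimes> ribbon K"
  define a where "a = Abs_fps ?L"
  define b where "b = Abs_fps (\<lambda>n. gamma_wedge (S n))"
  have level: "{p \<in> ?A. weight (fst p) = n} = {(H, K). weight H = n \<and> weight K = n \<and> Des H \<inter> Des K = {}}" for n
    by auto
  have hom_a: "homogeneous n (fps_nth a n)" for n
    by (simp add: a_def homogeneous_Lam_tensor)
  have hom_b: "homogeneous n (fps_nth b n)" for n
    unfolding b_def gamma_wedge_S fps_nth_Abs_fps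
    by (rule homogeneous_sum) (auto simp: homogeneous_ribbon_tensor)
  have sum_a: "(?L has_sum graded_sum (fps_nth a)) UNIV"
  proof -
    have "fps_nth a = ?L" by (rule ext) (simp add: a_def)
    then show ?thesis
      using has_sum_graded[of UNIV "\<lambda>n. n" ?L] homogeneous_Lam_tensor by simp
  qed
  have "(?R has_sum graded_sum (\<lambda>n. \<Sum>p | p \<in> ?A \<and> weight (fst p) = n. ?R p)) ?A"
  proof (rule has_sum_graded)
    fix n
    have "{(H, K). weight H = n \<and> weight K = n \<and> Des H \<inter> Des K = {}} \<subseteq> {H. weight H = n} \<times> {K. weight K = n}"
      by auto
    then show "finite {p \<in> ?A. weight (fst p) = n}"
      unfolding level by (rule finite_subset) simp
  qed (auto simp: homogeneous_ribbon_tensor)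
  then have sum_b: "(?R has_sum graded_sum (fps_nth b)) ?A"
  proof -
    have "fps_nth b = (\<lambda>n. \<Sum>p | p \<in> ?A \<and> weight (fst p) = n. ?R p)"
      unfolding level by (rule ext) (simp add: b_def gamma_wedge_S)
    then show ?thesis using \<open>(?R has_sum _) ?A\<close> by simp
  qed
  have ab: "a * b = 1"
  proof (rule fps_ext)
    fix n
    have "fps_nth (a * b) n = (\<Sum>k\<le>n. ?L k * gamma_wedge (S (n - k)))"
      by (simp add: fps_mult_nth a_def b_def atMost_atLeast0)
    also have "\<dots> = gamma_wedge (\<Sum>k\<le>n. (-1) ^ k * Lam k * S (n - k))"
      by (simp add: gamma_wedge.sum gamma_wedge_mult gamma_wedge_sign gamma_wedge_Lam mult.assoc)
    also have "\<dots> = fps_nth 1 n"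
      using Lam_S_relation[of n] by (cases "n = 0") (simp_all add: S_def gamma_wedge_one gamma_wedge.zero)
    finally show "fps_nth (a * b) n = fps_nth 1 n" .
  qed
  have ba: "b * a = 1"
    by (rule fps_mult_eq_1_commute[OF ab]) (simp add: b_def S_def gamma_wedge_one)
  have "graded_sum (fps_nth a) * graded_sum (fps_nth b) = 1"
    "graded_sum (fps_nth b) * graded_sum (fps_nth a) = 1"
    using graded_sum_fps_mult[OF hom_a hom_b] graded_sum_fps_mult[OF hom_b hom_a]
    by (simp_all add: ab ba graded_sum_one)
  then show ?thesis
    using linear_eqI_Lam[OF _ linear_gamma_wedge _ gamma_wedge_mult]
      has_sum_imp_summable[OF sum_a] has_sum_imp_summable[OF sum_b]
    unfolding infsumI[OF sum_a] infsumI[OF sum_b]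
    by (simp add: gamma_wedge_mult gamma_wedge_Lam)
qed

end
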